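(* Let $G$ be a finite transitive permutation group on a finite set $\Omega$. The following two conditions are equivalent: (a) $G$ has the $2$-id property; (b) for every orbit $O$ of $G$ on $2$-element subsets of $\Omega$, and every maximal block of imprimitivity $B$ for $G$ acting on $O$, the graph with vertex set $\Omega$ and edge set $O\setminus B$ is connected.
   Context: The rank of a map is the size of its image. For a map $t:\Omega\to\Omega$, $\langle G,t\rangle$ is the semigroup generated by $G\cup\{t\}$. $G$ has the $2$-id property if for every map $t:\Omega\to\Omega$ of rank $2$, the semigroup $\langle G,t\rangle\setminus G$ is generated by its idempotents (in general the paper considers the analogous $k$-id property, for maps of rank $k$, with $k\le |\Omega|/2$). A block of imprimitivity for $G$ acting on $O$ is a nonempty subset $B\subseteq O$ such that for each $g\in G$ either $Bg=B$ or $Bg\cap B=\emptyset$; a maximal block is one that is maximal under inclusion among the blocks different from $O$ (it may be a singleton). *)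

theory Defs
  imports "HOL-Algebra.Group_Action"
begin

text \<open>A permutation group on \<open>\<Omega>\<close> is a subgroup of \<^term>\<open>BijGroup \<Omega>\<close>, and a map from
  \<open>\<Omega>\<close> to \<open>\<Omega>\<close> is an element of \<^term>\<open>\<Omega> \<rightarrow>\<^sub>E \<Omega>\<close>: as in \<^term>\<open>BijGroup \<Omega>\<close>, functions are
  extensional, so that equality of functions is equality on \<open>\<Omega>\<close>.  Maps are written on the left;
  writing them on the right only reverses the multiplication and changes none of the notions
  below.\<close>

definition perm_group :: "'a set \<Rightarrow> ('a \<Rightarrow> 'a) set \<Rightarrow> ('a \<Rightarrow> 'a) monoid" where
  "perm_group \<Omega> G = (BijGroup \<Omega>)\<lparr>carrier := G\<rparr>"

inductive_set semigroup_gen :: "'a set \<Rightarrow> ('a \<Rightarrow> 'a) set \<Rightarrow> ('a \<Rightarrow> 'a) set"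
  for \<Omega> :: "'a set" and A :: "('a \<Rightarrow> 'a) set" where
  base: "f \<in> A \<Longrightarrow> f \<in> semigroup_gen \<Omega> A"
| mult: "f \<in> semigroup_gen \<Omega> A \<Longrightarrow> g \<in> semigroup_gen \<Omega> A \<Longrightarrow> compose \<Omega> f g \<in> semigroup_gen \<Omega> A"

definition idempotent_generated :: "'a set \<Rightarrow> ('a \<Rightarrow> 'a) set \<Rightarrow> bool" where
  "idempotent_generated \<Omega> S \<longleftrightarrow> semigroup_gen \<Omega> {e \<in> S. compose \<Omega> e e = e} = S"

definition map_rank :: "'a set \<Rightarrow> ('a \<Rightarrow> 'a) \<Rightarrow> nat" where
  "map_rank \<Omega> t = card (t ` \<Omega>)"

definition k_id_property :: "nat \<Rightarrow> 'a set \<Rightarrow> ('a \<Rightarrow> 'a) set \<Rightarrow> bool" where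
  "k_id_property k \<Omega> G \<longleftrightarrow>
     (\<forall>t \<in> \<Omega> \<rightarrow>\<^sub>E \<Omega>. map_rank \<Omega> t = k \<longrightarrow>
        idempotent_generated \<Omega> (semigroup_gen \<Omega> (G \<union> {t}) - G))"

text \<open>As with \<^const>\<open>orbits\<close>, the action \<open>\<phi>\<close> of \<open>G\<close> on \<open>E\<close> matters only through its values on \<open>E\<close>.
  For permutations acting on sets of points, \<open>\<phi>\<close> is the image operator.\<close>

definition imprimitivity_block ::
    "('g, 'm) monoid_scheme \<Rightarrow> 'b set \<Rightarrow> ('g \<Rightarrow> 'b \<Rightarrow> 'b) \<Rightarrow> 'b set \<Rightarrow> bool" where
  "imprimitivity_block G E \<phi> B \<longleftrightarrow>
     B \<subseteq> E \<and> B \<noteq> {} \<and> (\<forall>g \<in> carrier G. \<phi> g ` B = B \<or> \<phi> g ` B \<inter> B = {})"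

definition maximal_block ::
    "('g, 'm) monoid_scheme \<Rightarrow> 'b set \<Rightarrow> ('g \<Rightarrow> 'b \<Rightarrow> 'b) \<Rightarrow> 'b set \<Rightarrow> bool" where
  "maximal_block G E \<phi> B \<longleftrightarrow>
     imprimitivity_block G E \<phi> B \<and> B \<noteq> E \<and>
     (\<forall>B'. imprimitivity_block G E \<phi> B' \<and> B' \<noteq> E \<and> B \<subseteq> B' \<longrightarrow> B' = B)"

definition two_subsets :: "'a set \<Rightarrow> 'a set set" where
  "two_subsets \<Omega> = {e. e \<subseteq> \<Omega> \<and> card e = 2}"

definition graph_connected :: "'a set \<Rightarrow> 'a set set \<Rightarrow> bool" where
  "graph_connected V E \<longleftrightarrow> (\<forall>x \<in> V. \<forall>y \<in> V. (x, y) \<in> {(u, v). {u, v} \<in> E}\<^sup>*)"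

end

theory Submission
  imports Defs
begin

text \<open>
  Let \<open>t\<close> have rank two and let \<open>Orb\<close> be the orbit of \<open>G\<close> on pairs that contains its image; regard
  the pairs in \<open>Orb\<close> as edges.  An element of rank two in the semigroup generated by \<open>G\<close> and \<open>t\<close>
  is described by its kernel, which is a translate of the kernel partition of \<open>t\<close>, by its image,
  which is an edge, and by one of the two bijections between them (\<open>semigroup_gen_cases\<close>).  It
  can be idempotent only if the edge crosses the partition.  In a product of such maps the kernel is that
  of the rightmost factor and the image that of the leftmost one; the product has rank two precisely
  when the image of each factor crosses the kernel of the next factor to its left.

  Suppose that removing a proper block \<open>B\<close> disconnects \<open>Orb\<close>.  Choose \<open>t\<close> so that its kernel separates
  the vertices without cutting an edge outside \<open>B\<close>, and so that its image is an edge outside \<open>B\<close>.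
  Then every edge that crosses a translate of the kernel lies in the corresponding translate of
  \<open>B\<close>.  Consecutive factors of a product of idempotents are thereby tied to the same translate of
  \<open>B\<close>, so kernel and image of the product match, whereas those of \<open>t\<close> do not
  (\<open>idempotent_products_stay_in_block\<close>).

  Conversely, assume the connectedness condition, called \<open>road_closed\<close> below.  Multiplying on the
  left by an idempotent moves the image from one edge to another when both cross a common translate
  of the kernel, matching the ends that lie on the same side (\<open>two_valued_map_step\<close>).  So it suffices that these
  moves connect all arcs, that is, all edges with an orientation (\<open>arc_step_connected\<close>).  The edges
  reachable from a given one form a block.  If the block were proper, then some partition would be crossed
  only by edges of the block, and removing it would disconnect the graph (\<open>arc_step_reaches_edge\<close>).
  If no edge could be reversed, the reachable arcs would form an orientation of the graph, preserved
  or reversed by each element of \<open>G\<close>.  Out-degree minus in-degree then changes at most its sign under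
  \<open>G\<close> and sums to zero.  It is not identically zero, because all edges crossing a suitable
  partition point in the same direction.  The points where it is positive and those
  where it is negative are therefore two nonempty classes permuted by \<open>G\<close>, and two points of one
  class have an orbit of pairs whose graph is disconnected (\<open>signed_invariant_vanishes\<close>,
  \<open>arc_step_reverses\<close>).

  A map of rank at most one is idempotent.  If \<open>\<Omega>\<close> has just two points, then a map of rank two is a
  permutation and belongs to \<open>G\<close>, so that nothing is left to generate.
\<close>

section \<open>Graphs and blocks\<close>

lemma graph_connected_cut:
  assumes "graph_connected V E" "x \<in> V" "y \<in> V" "x \<in> X" "y \<notin> X"
  obtains u v where "{u, v} \<in> E" "u \<in> X" "v \<notin> X"
proof -
  have "(x, y) \<in> {(u, v). {u, v} \<in> E}\<^sup>*"
    using assms by (simp add: graph_connected_def)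
  hence "y \<notin> X \<longrightarrow> (\<exists>u v. {u, v} \<in> E \<and> u \<in> X \<and> v \<notin> X)"
    using assms(4) by induction auto
  with assms(5) that show thesis by blast
qed

lemma graph_not_connected_cut:
  assumes "\<not> graph_connected V E"
  obtains P x y where "x \<in> V \<inter> P" "y \<in> V - P" "\<forall>u v. {u, v} \<in> E \<longrightarrow> (u \<in> P \<longleftrightarrow> v \<in> P)"
proof -
  let ?R = "{(u, v). {u, v} \<in> E}"
  obtain x y where xy: "x \<in> V" "y \<in> V" "(x, y) \<notin> ?R\<^sup>*"
    using assms by (auto simp: graph_connected_def)
  have step: "(x, v) \<in> ?R\<^sup>*" if "(x, u) \<in> ?R\<^sup>*" "{u, v} \<in> E" for u v
    using that by (auto intro: rtrancl_into_rtrancl)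
  have "(x, u) \<in> ?R\<^sup>* \<longleftrightarrow> (x, v) \<in> ?R\<^sup>*" if "{u, v} \<in> E" for u v
    using step[of u v] step[of v u] that by (auto simp: insert_commute)
  thus thesis
    using xy that[of x "{z. (x, z) \<in> ?R\<^sup>*}" y] by auto
qed

lemma graph_connected_mono:
  assumes "graph_connected V E" "E \<subseteq> F"
  shows "graph_connected V F"
proof -
  have "{(u, v). {u, v} \<in> E}\<^sup>* \<subseteq> {(u, v). {u, v} \<in> F}\<^sup>*"
    using assms(2) by (intro rtrancl_mono) auto
  thus ?thesis using assms(1) unfolding graph_connected_def by blast
qed

lemma rtrancl_image:
  assumes "(a, b) \<in> R\<^sup>*" "\<And>x y. (x, y) \<in> R \<Longrightarrow> (f x, f y) \<in> S"
  shows "(f a, f b) \<in> S\<^sup>*"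
  using assms(1) by induction (auto intro: rtrancl_into_rtrancl assms(2))

lemma proper_block_in_maximal_block:
  assumes "finite E" "imprimitivity_block G E \<phi> C" "C \<noteq> E"
  obtains B where "maximal_block G E \<phi> B" "C \<subseteq> B"
proof -
  let ?F = "{B. imprimitivity_block G E \<phi> B \<and> B \<noteq> E}"
  have "finite ?F"
    by (rule finite_subset[of _ "Pow E"]) (auto simp: imprimitivity_block_def assms(1))
  moreover have "C \<in> ?F" using assms by simp
  ultimately obtain B where "B \<in> ?F" "C \<subseteq> B" "\<forall>B' \<in> ?F. B \<subseteq> B' \<longrightarrow> B = B'"
    using finite_has_maximal2[of ?F C] by blast
  thus thesis by (intro that[of B]) (auto simp: maximal_block_def)
qed

section \<open>Orbits of a transitive permutation group on pairs of points\<close>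

locale transitive_perm_group =
  fixes \<Omega> :: "'a set" and G :: "('a \<Rightarrow> 'a) set"
  assumes finite_points: "finite \<Omega>"
    and subgroup_BijGroup: "subgroup G (BijGroup \<Omega>)"
    and transitive_on_points: "transitive_action (perm_group \<Omega> G) \<Omega> (\<lambda>g. g)"
begin

lemma carrier_perm_group [simp]: "carrier (perm_group \<Omega> G) = G"
  by (simp add: perm_group_def)

lemma G_Bij: "g \<in> G \<Longrightarrow> g \<in> Bij \<Omega>"
  using subgroup.subset[OF subgroup_BijGroup] by (auto simp: BijGroup_def)

lemma G_maps: "g \<in> G \<Longrightarrow> g \<in> \<Omega> \<rightarrow>\<^sub>E \<Omega>"
  using G_Bij[of g] by (auto simp: Bij_def PiE_def bij_betw_def)

lemma G_image: "g \<in> G \<Longrightarrow> g ` \<Omega> = \<Omega>"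
  using G_Bij[of g] by (auto simp: Bij_def bij_betw_def)

lemma G_inj: "g \<in> G \<Longrightarrow> inj_on g \<Omega>"
  using G_Bij[of g] by (auto simp: Bij_def bij_betw_def)

lemma G_point: "g \<in> G \<Longrightarrow> x \<in> \<Omega> \<Longrightarrow> g x \<in> \<Omega>"
  using G_image by blast

lemma G_eq_iff: "g \<in> G \<Longrightarrow> x \<in> \<Omega> \<Longrightarrow> y \<in> \<Omega> \<Longrightarrow> g x = g y \<longleftrightarrow> x = y"
  using G_inj by (meson inj_on_eq_iff)

lemma G_id: "(\<lambda>x\<in>\<Omega>. x) \<in> G"
  using subgroup.one_closed[OF subgroup_BijGroup] by (simp add: BijGroup_def)

lemma G_compose: "g \<in> G \<Longrightarrow> h \<in> G \<Longrightarrow> compose \<Omega> g h \<in> G"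
  using subgroup.m_closed[OF subgroup_BijGroup, of g h] G_Bij by (simp add: BijGroup_def)

lemma G_inverse:
  assumes "g \<in> G"
  obtains h where "h \<in> G" "\<forall>x\<in>\<Omega>. h (g x) = x" "\<forall>x\<in>\<Omega>. g (h x) = x"
proof (rule that)
  let ?h = "\<lambda>x\<in>\<Omega>. inv_into \<Omega> g x"
  show "?h \<in> G"
    using subgroup.m_inv_closed[OF subgroup_BijGroup assms] inv_BijGroup[OF G_Bij[OF assms]]
    by simp
  show "\<forall>x\<in>\<Omega>. ?h (g x) = x"
    using assms G_inj G_point by simp
  show "\<forall>x\<in>\<Omega>. g (?h x) = x"
    using assms G_image by (simp add: f_inv_into_f)
qed

lemma G_transitive:
  assumes "x \<in> \<Omega>" "y \<in> \<Omega>"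
  obtains g where "g \<in> G" "g x = y"
  using transitive_action.unique_orbit[OF transitive_on_points assms] by auto

definition edge_orbits :: "'a set set set" where
  "edge_orbits = orbits (perm_group \<Omega> G) (two_subsets \<Omega>) (`)"

lemma edge_orbit_two_subset:
  assumes "Orb \<in> edge_orbits" "e \<in> Orb"
  shows "e \<subseteq> \<Omega>" "card e = 2"
proof -
  obtain e0 g where *: "e0 \<subseteq> \<Omega>" "card e0 = 2" "g \<in> G" "e = g ` e0"
    using assms by (auto simp: edge_orbits_def orbits_def orbit_def two_subsets_def)
  show "e \<subseteq> \<Omega>" using * G_point by blast
  have "inj_on g e0" using * G_inj inj_on_subset by blast
  thus "card e = 2" using * by (simp add: card_image)
qed

lemma edge_orbit_points:
  assumes "Orb \<in> edge_orbits" "{x, y} \<in> Orb"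
  shows "x \<in> \<Omega>" "y \<in> \<Omega>" "x \<noteq> y"
  using edge_orbit_two_subset[OF assms] by auto

lemma edge_orbit_finite: "Orb \<in> edge_orbits \<Longrightarrow> finite Orb"
  by (rule finite_subset[of _ "Pow \<Omega>"]) (auto dest: edge_orbit_two_subset simp: finite_points)

lemma edge_orbit_nonempty: "Orb \<in> edge_orbits \<Longrightarrow> Orb \<noteq> {}"
  using G_id by (auto simp: edge_orbits_def orbits_def orbit_def)

lemma compose_image: "A \<subseteq> \<Omega> \<Longrightarrow> compose \<Omega> f g ` A = f ` g ` A"
  unfolding image_image by (rule image_cong) (auto simp: compose_def)

lemma edge_orbit_closed:
  assumes "Orb \<in> edge_orbits" "e \<in> Orb" "g \<in> G"
  shows "g ` e \<in> Orb"
proof -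
  obtain e0 where e0: "e0 \<subseteq> \<Omega>" "Orb = {h ` e0 | h. h \<in> G}"
    using assms(1) by (auto simp: edge_orbits_def orbits_def orbit_def two_subsets_def)
  then obtain h where "h \<in> G" "e = h ` e0" using assms by auto
  hence "g ` e = compose \<Omega> g h ` e0" "compose \<Omega> g h \<in> G"
    using G_compose[OF assms(3)] by (simp_all add: compose_image e0(1))
  thus ?thesis unfolding e0(2) by blast
qed

text \<open>Translating back to a common base pair and forward again: orbits are defined from one base
  pair, whereas the later arguments compare two arbitrary edges.\<close>

lemma edge_orbit_transitive:
  assumes "Orb \<in> edge_orbits" "e \<in> Orb" "e' \<in> Orb"
  obtains g where "g \<in> G" "g ` e = e'"
proof -
  obtain e0 where e0: "e0 \<subseteq> \<Omega>" "Orb = {h ` e0 | h. h \<in> G}"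
    using assms(1) by (auto simp: edge_orbits_def orbits_def orbit_def two_subsets_def)
  then obtain h h' where h: "h \<in> G" "e = h ` e0" "h' \<in> G" "e' = h' ` e0" using assms by auto
  obtain k where k: "k \<in> G" "\<forall>x\<in>\<Omega>. k (h x) = x" using G_inverse[OF h(1)] by blast
  have ke: "k ` e = e0" using h(2) k(2) e0(1) by force
  have "e \<subseteq> \<Omega>" using edge_orbit_two_subset assms by blast
  hence "compose \<Omega> h' k ` e = e'" by (simp only: compose_image ke h(4))
  thus thesis by (rule that[OF G_compose[OF h(3) k(1)]])
qed

lemma edge_orbit_ex:
  assumes "e \<subseteq> \<Omega>" "card e = 2"
  obtains Orb where "Orb \<in> edge_orbits" "e \<in> Orb"
proof (rule that)
  show "orbit (perm_group \<Omega> G) (`) e \<in> edge_orbits"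
    using assms by (auto simp: edge_orbits_def orbits_def two_subsets_def)
  have "(\<lambda>x\<in>\<Omega>. x) ` e = e" using assms by force
  thus "e \<in> orbit (perm_group \<Omega> G) (`) e"
    unfolding orbit_def carrier_perm_group using G_id by blast
qed

section \<open>The semigroup generated by the group and a map of rank two\<close>

text \<open>A partition of the points is encoded by any function \<open>c\<close> that is constant exactly on its parts.
  For \<open>g\<close> in \<open>G\<close>, the function \<open>t \<circ> g\<close> encodes the translate by the inverse of \<open>g\<close> of the kernel
  of \<open>t\<close>.\<close>

definition has_kernel :: "('a \<Rightarrow> 'a) \<Rightarrow> ('a \<Rightarrow> 'b) \<Rightarrow> bool" where
  "has_kernel f c \<longleftrightarrow> (\<forall>x\<in>\<Omega>. \<forall>y\<in>\<Omega>. f x = f y \<longleftrightarrow> c x = c y)"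

lemma semigroup_gen_maps:
  assumes "A \<subseteq> \<Omega> \<rightarrow>\<^sub>E \<Omega>" "f \<in> semigroup_gen \<Omega> A"
  shows "f \<in> \<Omega> \<rightarrow>\<^sub>E \<Omega>"
  using assms(2)
proof induction
  case (mult f g)
  thus ?case by (auto simp: PiE_def compose_def Pi_def extensional_def)
qed (use assms in auto)

lemma compose_rank_le:
  assumes "h \<in> \<Omega> \<rightarrow>\<^sub>E \<Omega>"
  shows "card (compose \<Omega> f h ` \<Omega>) \<le> card (f ` \<Omega>)"
    and "card (compose \<Omega> f h ` \<Omega>) \<le> card (h ` \<Omega>)"
proof -
  have "f ` h ` \<Omega> \<subseteq> f ` \<Omega>" using assms by (intro image_mono) auto
  thus "card (compose \<Omega> f h ` \<Omega>) \<le> card (f ` \<Omega>)"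
    using finite_points by (simp add: compose_image card_mono)
  show "card (compose \<Omega> f h ` \<Omega>) \<le> card (h ` \<Omega>)"
    using finite_points by (simp add: compose_image card_image_le)
qed

text \<open>If no rank is lost, the left factor must be injective on the image of the right one; in other
  words, that image crosses the kernel of the left factor.\<close>

lemma compose_rank_two:
  assumes "f \<in> \<Omega> \<rightarrow>\<^sub>E \<Omega>" "h \<in> \<Omega> \<rightarrow>\<^sub>E \<Omega>" "card (f ` \<Omega>) = 2" "card (h ` \<Omega>) = 2"
    "\<not> card (compose \<Omega> f h ` \<Omega>) \<le> 1"
  shows "compose \<Omega> f h ` \<Omega> = f ` \<Omega>" "inj_on f (h ` \<Omega>)"
proof -
  have im: "compose \<Omega> f h ` \<Omega> = f ` h ` \<Omega>" by (simp add: compose_image)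
  have h\<Omega>: "h ` \<Omega> \<subseteq> \<Omega>" using assms(2) by auto
  have sub: "compose \<Omega> f h ` \<Omega> \<subseteq> f ` \<Omega>" using im h\<Omega> by auto
  show eq: "compose \<Omega> f h ` \<Omega> = f ` \<Omega>"
    by (rule card_seteq) (use sub assms finite_points in auto)
  show "inj_on f (h ` \<Omega>)"
    by (rule eq_card_imp_inj_on) (use eq im assms finite_points in auto)
qed

lemma compose_has_kernel:
  assumes "inj_on f (h ` \<Omega>)" "has_kernel h c"
  shows "has_kernel (compose \<Omega> f h) c"
  using assms by (auto simp: has_kernel_def compose_def inj_on_eq_iff)

text \<open>Multiplying by an element of \<open>G\<close> translates the kernel or the image, and a product of two maps
  of rank two that still has rank two takes its kernel from the right factor and its image from the
  left factor.\<close>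

lemma semigroup_gen_cases:
  assumes t: "t \<in> \<Omega> \<rightarrow>\<^sub>E \<Omega>" "Orb \<in> edge_orbits" "t ` \<Omega> \<in> Orb"
    and f: "f \<in> semigroup_gen \<Omega> (G \<union> {t})"
  shows "f \<in> G \<or> card (f ` \<Omega>) \<le> 1 \<or> (f ` \<Omega> \<in> Orb \<and> (\<exists>g\<in>G. has_kernel f (t \<circ> g)))"
  using f
proof induction
  case (base f)
  have "has_kernel t (t \<circ> (\<lambda>x\<in>\<Omega>. x))" by (auto simp: has_kernel_def)
  thus ?case using base t G_id by blast
next
  case (mult f h)
  let ?c = "compose \<Omega> f h"
  have maps: "f \<in> \<Omega> \<rightarrow>\<^sub>E \<Omega>" "h \<in> \<Omega> \<rightarrow>\<^sub>E \<Omega>"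
    using semigroup_gen_maps[of "G \<union> {t}"] mult G_maps t by auto
  have im: "?c ` \<Omega> = f ` h ` \<Omega>" by (simp add: compose_image)
  have h\<Omega>: "h ` \<Omega> \<subseteq> \<Omega>" using maps(2) by auto
  show ?case
  proof (cases "card (?c ` \<Omega>) \<le> 1")
    case False
    have f1: "\<not> card (f ` \<Omega>) \<le> 1" and h1: "\<not> card (h ` \<Omega>) \<le> 1"
      using False compose_rank_le[OF maps(2), of f] by linarith+
    consider (GG) "f \<in> G" "h \<in> G"
      | (Gt) "f \<in> G" "h ` \<Omega> \<in> Orb" "\<exists>g\<in>G. has_kernel h (t \<circ> g)"
      | (tG) "f ` \<Omega> \<in> Orb" "\<exists>g\<in>G. has_kernel f (t \<circ> g)" "h \<in> G"
      | (tt) "f ` \<Omega> \<in> Orb" "h ` \<Omega> \<in> Orb" "\<exists>g\<in>G. has_kernel h (t \<circ> g)"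
      using mult.IH f1 h1 by blast
    thus ?thesis
    proof cases
      case GG
      thus ?thesis using G_compose by blast
    next
      case Gt
      have "inj_on f (h ` \<Omega>)" using G_inj[OF Gt(1)] h\<Omega> inj_on_subset by blast
      thus ?thesis
        using Gt(3) edge_orbit_closed[OF t(2) Gt(2,1)] compose_has_kernel unfolding im by blast
    next
      case tG
      then obtain g where g: "g \<in> G" "has_kernel f (t \<circ> g)" by blast
      have "has_kernel ?c (t \<circ> compose \<Omega> g h)"
        using g(2) tG(3) G_point by (auto simp: has_kernel_def compose_def)
      moreover have "?c ` \<Omega> = f ` \<Omega>" using im G_image tG by simp
      moreover have "compose \<Omega> g h \<in> G" using G_compose g(1) tG(3) by blast
      ultimately show ?thesis using tG(1) by metis
    next
      case tt
      hence "card (f ` \<Omega>) = 2" "card (h ` \<Omega>) = 2"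
        using edge_orbit_two_subset[OF t(2)] by auto
      note * = compose_rank_two[OF maps this False]
      show ?thesis using tt(1,3) compose_has_kernel[OF *(2)] unfolding *(1) by blast
    qed
  qed simp
qed

section \<open>Generation by idempotents forces connectedness\<close>

text \<open>Two translates of \<open>B\<close> that share the edge \<open>e\<close> coincide.\<close>

lemma block_invariant:
  assumes "imprimitivity_block (perm_group \<Omega> G) Orb (`) B" "Orb \<in> edge_orbits"
    "g1 \<in> G" "g2 \<in> G" "e \<in> Orb" "e' \<in> Orb" "g1 ` e \<in> B" "g2 ` e \<in> B" "g1 ` e' \<in> B"
  shows "g2 ` e' \<in> B"
proof -
  obtain h where h: "h \<in> G" "\<forall>x\<in>\<Omega>. h (g1 x) = x" using G_inverse[OF assms(3)] by blast
  have sub: "e \<subseteq> \<Omega>" "e' \<subseteq> \<Omega>" "g1 ` e \<subseteq> \<Omega>" "g1 ` e' \<subseteq> \<Omega>"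
    using edge_orbit_two_subset[OF assms(2)] assms edge_orbit_closed[OF assms(2)] by blast+
  have undo: "h ` g1 ` d = d" if "d \<subseteq> \<Omega>" for d
    using h(2) that by force
  let ?k = "compose \<Omega> g2 h"
  have k: "?k ` g1 ` d = g2 ` d" if "d \<subseteq> \<Omega>" for d
  proof -
    have "g1 ` d \<subseteq> \<Omega>" using that G_point assms(3) by blast
    thus ?thesis by (simp only: compose_image undo[OF that])
  qed
  have "?k \<in> G" using G_compose assms h by blast
  moreover have "?k ` g1 ` e \<in> (`) ?k ` B" using assms by blast
  moreover have "?k ` g1 ` e \<in> B" using assms by (simp only: k[OF sub(1)])
  ultimately have "(`) ?k ` B = B"
    using assms(1) unfolding imprimitivity_block_def carrier_perm_group by blast
  hence "?k ` g1 ` e' \<in> B" using assms(9) by blast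
  thus ?thesis by (simp only: k[OF sub(2)])
qed

text \<open>The assumption \<open>cut\<close> says that only edges of \<open>B\<close> cross the kernel of \<open>t\<close>.  An idempotent of
  rank two has an image that crosses its own kernel, so this image lies in the translate of \<open>B\<close>
  belonging to the kernel.  In a product, the image of the right factor crosses the kernel of the
  left factor, which forces the translates of \<open>B\<close> belonging to the two factors to be equal.

  The kernel of \<open>f\<close> may be encoded as \<open>t \<circ> g\<close> by several \<open>g\<close>.  The conclusion is stated for all
  of them, so that it can be applied to \<open>t\<close> itself with the identity.\<close>

lemma idempotent_products_stay_in_block:
  assumes t: "t \<in> \<Omega> \<rightarrow>\<^sub>E \<Omega>" "Orb \<in> edge_orbits" "t ` \<Omega> \<in> Orb"
    and B: "imprimitivity_block (perm_group \<Omega> G) Orb (`) B"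
    and cut: "\<And>u v. {u, v} \<in> Orb \<Longrightarrow> t u \<noteq> t v \<Longrightarrow> {u, v} \<in> B"
    and f: "f \<in> semigroup_gen \<Omega> {e \<in> semigroup_gen \<Omega> (G \<union> {t}) - G. compose \<Omega> e e = e}"
  shows "card (f ` \<Omega>) \<le> 1 \<or>
    f ` \<Omega> \<in> Orb \<and> (\<exists>g\<in>G. has_kernel f (t \<circ> g)) \<and> (\<forall>g\<in>G. has_kernel f (t \<circ> g) \<longrightarrow> g ` f ` \<Omega> \<in> B)"
  using f
proof induction
  case (base e)
  have maps: "e \<in> \<Omega> \<rightarrow>\<^sub>E \<Omega>"
    using semigroup_gen_maps[of "G \<union> {t}" e] base G_maps t by auto
  have "g ` e ` \<Omega> \<in> B" if im: "e ` \<Omega> \<in> Orb" and g: "g \<in> G" "has_kernel e (t \<circ> g)" for g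
  proof -
    obtain u v where uv: "e ` \<Omega> = {u, v}" "u \<noteq> v"
      using edge_orbit_two_subset[OF t(2) im] by (auto simp: card_2_iff)
    have fixed: "e x = x" if "x \<in> e ` \<Omega>" for x
    proof -
      from that obtain y where y: "y \<in> \<Omega>" "x = e y" by blast
      have "compose \<Omega> e e y = e y" using base by simp
      thus ?thesis using y by (simp add: compose_def)
    qed
    have mem: "u \<in> \<Omega>" "v \<in> \<Omega>" using uv edge_orbit_two_subset[OF t(2) im] by auto
    have "e u = u" "e v = v" using fixed uv(1) by blast+
    hence "t (g u) \<noteq> t (g v)"
      using g(2) mem uv(2) unfolding has_kernel_def comp_def by metis
    moreover have "{g u, g v} \<in> Orb" using edge_orbit_closed[OF t(2) im g(1)] uv by simp
    ultimately show ?thesis using cut uv by simp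
  qed
  thus ?case using semigroup_gen_cases[OF t, of e] base by blast
next
  case (mult f h)
  let ?c = "compose \<Omega> f h"
  let ?S = "{e \<in> semigroup_gen \<Omega> (G \<union> {t}) - G. compose \<Omega> e e = e}"
  have "?S \<subseteq> \<Omega> \<rightarrow>\<^sub>E \<Omega>" using semigroup_gen_maps[of "G \<union> {t}"] G_maps t by blast
  hence maps: "f \<in> \<Omega> \<rightarrow>\<^sub>E \<Omega>" "h \<in> \<Omega> \<rightarrow>\<^sub>E \<Omega>"
    using semigroup_gen_maps mult.hyps by blast+
  have h\<Omega>: "h ` \<Omega> \<subseteq> \<Omega>" using maps(2) by auto
  show ?case
  proof (cases "card (?c ` \<Omega>) \<le> 1")
    case False
    have f1: "\<not> card (f ` \<Omega>) \<le> 1" and h1: "\<not> card (h ` \<Omega>) \<le> 1"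
      using False compose_rank_le[OF maps(2), of f] by linarith+
    have ih: "f ` \<Omega> \<in> Orb" "h ` \<Omega> \<in> Orb" "\<exists>g\<in>G. has_kernel h (t \<circ> g)"
      "\<And>g. g \<in> G \<Longrightarrow> has_kernel h (t \<circ> g) \<Longrightarrow> g ` h ` \<Omega> \<in> B"
      using mult.IH f1 h1 by blast+
    obtain g1 where g1: "g1 \<in> G" "has_kernel f (t \<circ> g1)" "g1 ` f ` \<Omega> \<in> B"
      using mult.IH f1 by blast
    have card2: "card (f ` \<Omega>) = 2" "card (h ` \<Omega>) = 2"
      using edge_orbit_two_subset[OF t(2)] ih by auto
    have eq: "?c ` \<Omega> = f ` \<Omega>" and inj: "inj_on f (h ` \<Omega>)"
      using compose_rank_two[OF maps card2 False] by auto
    obtain u v where uv: "h ` \<Omega> = {u, v}" "u \<noteq> v"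
      using card2(2) by (auto simp: card_2_iff)
    have mem: "u \<in> \<Omega>" "v \<in> \<Omega>" using uv h\<Omega> by auto
    have "f u \<noteq> f v" using inj uv by (auto simp: inj_on_def)
    hence "t (g1 u) \<noteq> t (g1 v)" using g1(2) mem by (auto simp: has_kernel_def)
    moreover have "{g1 u, g1 v} \<in> Orb" using edge_orbit_closed[OF t(2) ih(2) g1(1)] uv by simp
    \<comment> \<open>The edge \<open>h ` \<Omega>\<close> crosses the kernel of \<open>f\<close> and hence lies in the translates of both factors.\<close>
    ultimately have hB: "g1 ` h ` \<Omega> \<in> B" using cut uv by simp
    have "g ` ?c ` \<Omega> \<in> B" if g: "g \<in> G" "has_kernel ?c (t \<circ> g)" for g
    proof -
      have "has_kernel h (t \<circ> g)"
        using g(2) inj by (auto simp: has_kernel_def compose_def inj_on_eq_iff)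
      hence "g ` h ` \<Omega> \<in> B" using ih g by blast
      thus ?thesis
        unfolding eq using block_invariant[OF B t(2) g1(1) g(1) ih(2) ih(1) hB _ g1(3)] by blast
    qed
    moreover have "\<exists>g\<in>G. has_kernel ?c (t \<circ> g)" using ih(3) compose_has_kernel[OF inj] by blast
    ultimately show ?thesis using ih(1) unfolding eq by blast
  qed simp
qed

text \<open>The map to which the previous lemma applies collapses a union of components of the graph on
  \<open>Orb - B\<close> to one end of an edge outside \<open>B\<close>, and all other points to the other end.\<close>

theorem two_id_imp_connected:
  assumes id2: "k_id_property 2 \<Omega> G" and Orb: "Orb \<in> edge_orbits"
    and B: "imprimitivity_block (perm_group \<Omega> G) Orb (`) B" "B \<noteq> Orb"
  shows "graph_connected \<Omega> (Orb - B)"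
proof (rule ccontr)
  assume "\<not> graph_connected \<Omega> (Orb - B)"
  then obtain P a b where P: "a \<in> \<Omega> \<inter> P" "b \<in> \<Omega> - P"
    "\<forall>u v. {u, v} \<in> Orb - B \<longrightarrow> (u \<in> P \<longleftrightarrow> v \<in> P)"
    by (rule graph_not_connected_cut)
  have sub: "B \<subseteq> Orb" "B \<noteq> {}" using B(1) by (auto simp: imprimitivity_block_def)
  then obtain o1 o2 where o12: "o1 \<in> Orb" "o1 \<notin> B" "o2 \<in> Orb" "o1 \<noteq> o2" using B(2) by blast
  then obtain u v where uv: "o1 = {u, v}" "u \<noteq> v"
    using edge_orbit_two_subset[OF Orb, of o1] by (auto simp: card_2_iff)
  \<comment> \<open>Two distinct edges need a third point, which keeps a map of rank two out of \<open>G\<close>.\<close>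
  have "card \<Omega> \<noteq> 2"
  proof
    assume "card \<Omega> = 2"
    hence "o1 = \<Omega>" "o2 = \<Omega>"
      using edge_orbit_two_subset[OF Orb] o12 finite_points by (simp_all add: card_subset_eq)
    thus False using o12 by simp
  qed
  define t where "t = (\<lambda>z\<in>\<Omega>. if z \<in> P then u else v)"
  have uv\<Omega>: "u \<in> \<Omega>" "v \<in> \<Omega>" using edge_orbit_two_subset[OF Orb o12(1)] uv by auto
  have t_maps: "t \<in> \<Omega> \<rightarrow>\<^sub>E \<Omega>" using uv\<Omega> by (auto simp: t_def)
  have t_im: "t ` \<Omega> = {u, v}" using P(1,2) by (auto simp: t_def)
  hence t_Orb: "t ` \<Omega> \<in> Orb" using o12 uv by simp
  have rank: "map_rank \<Omega> t = 2" using t_im uv by (simp add: map_rank_def)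
  have "t \<notin> G" using G_image[of t] rank \<open>card \<Omega> \<noteq> 2\<close> by (auto simp: map_rank_def)
  hence "t \<in> semigroup_gen \<Omega> (G \<union> {t}) - G" by (auto intro: semigroup_gen.base)
  hence gen: "t \<in> semigroup_gen \<Omega> {e \<in> semigroup_gen \<Omega> (G \<union> {t}) - G. compose \<Omega> e e = e}"
    using id2 t_maps rank by (simp add: k_id_property_def idempotent_generated_def)
  have cut: "{x, y} \<in> B" if "{x, y} \<in> Orb" "t x \<noteq> t y" for x y
  proof -
    have "x \<in> \<Omega>" "y \<in> \<Omega>" using edge_orbit_points[OF Orb that(1)] by auto
    thus ?thesis using P(3)[rule_format, of x y] that by (auto simp: t_def split: if_splits)
  qed
  have "has_kernel t (t \<circ> (\<lambda>x\<in>\<Omega>. x))" by (auto simp: has_kernel_def)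
  moreover have "\<not> card (t ` \<Omega>) \<le> 1" using rank by (simp add: map_rank_def)
  ultimately have "(\<lambda>x\<in>\<Omega>. x) ` t ` \<Omega> \<in> B"
    using idempotent_products_stay_in_block[OF t_maps Orb t_Orb B(1) cut gen] G_id by blast
  moreover have "(\<lambda>x\<in>\<Omega>. x) ` t ` \<Omega> = o1" using t_im uv uv\<Omega> by auto
  ultimately show False using o12 by simp
qed

section \<open>Road closure makes every edge orbit connected\<close>

definition road_closed :: bool where
  "road_closed \<longleftrightarrow> (\<forall>Orb\<in>edge_orbits. \<forall>B.
     maximal_block (perm_group \<Omega> G) Orb (`) B \<longrightarrow> graph_connected \<Omega> (Orb - B))"

text \<open>Some point is not in \<open>e\<close>, and \<open>G\<close> moves an end of \<open>e\<close> to it.\<close>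

lemma edge_orbit_not_singleton:
  assumes "card \<Omega> \<noteq> 2" "Orb \<in> edge_orbits" "e \<in> Orb"
  shows "Orb \<noteq> {e}"
proof -
  have e: "e \<subseteq> \<Omega>" "card e = 2" using edge_orbit_two_subset assms by auto
  hence "e \<noteq> \<Omega>" using assms(1) by auto
  then obtain z where z: "z \<in> \<Omega>" "z \<notin> e" using e by blast
  obtain x where x: "x \<in> e" using e(2) by fastforce
  obtain g where "g \<in> G" "g x = z" using G_transitive[of x z] x e z by blast
  hence "g ` e \<in> Orb" "z \<in> g ` e" using edge_orbit_closed assms(2,3) x by auto
  thus ?thesis using z by auto
qed

lemma road_closed_proper_block:
  assumes "road_closed" "Orb \<in> edge_orbits"
    "imprimitivity_block (perm_group \<Omega> G) Orb (`) C" "C \<noteq> Orb"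
  shows "graph_connected \<Omega> (Orb - C)"
proof -
  obtain B where "maximal_block (perm_group \<Omega> G) Orb (`) B" "C \<subseteq> B"
    using proper_block_in_maximal_block[OF edge_orbit_finite[OF assms(2)] assms(3,4)] by blast
  thus ?thesis using assms(1,2) graph_connected_mono[of \<Omega> "Orb - B" "Orb - C"]
    unfolding road_closed_def by blast
qed

text \<open>A single edge is a proper block, and already the graph without a maximal block around it is
  connected.\<close>

lemma edge_orbit_connected:
  assumes "road_closed" "card \<Omega> \<noteq> 2" "Orb \<in> edge_orbits"
  shows "graph_connected \<Omega> Orb"
proof -
  obtain e where e: "e \<in> Orb" using edge_orbit_nonempty assms by blast
  have "imprimitivity_block (perm_group \<Omega> G) Orb (`) {e}"
    using e by (auto simp: imprimitivity_block_def)
  hence "graph_connected \<Omega> (Orb - {e})"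
    using road_closed_proper_block edge_orbit_not_singleton assms e by metis
  thus ?thesis by (rule graph_connected_mono) blast
qed

text \<open>A nonzero value anywhere gives, by transitivity, a nonzero value of the same modulus
  everywhere.  Since the values sum to zero, both signs occur, and with more than two points one of
  them occurs twice.  Each element of \<open>G\<close> preserves or exchanges the two sign classes, so the
  translates of a pair within one class never join the two classes, and the orbit of this pair is
  not connected.\<close>

lemma signed_invariant_vanishes:
  fixes \<delta> :: "'a \<Rightarrow> int"
  assumes rc: "road_closed" "card \<Omega> \<noteq> 2"
    and inv: "\<And>g. g \<in> G \<Longrightarrow> \<exists>\<epsilon>\<in>{1, -1}. \<forall>x\<in>\<Omega>. \<delta> (g x) = \<epsilon> * \<delta> x"
    and sum0: "(\<Sum>x\<in>\<Omega>. \<delta> x) = 0" and x: "x \<in> \<Omega>"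
  shows "\<delta> x = 0"
proof (rule ccontr)
  assume nz: "\<delta> x \<noteq> 0"
  have all_nz: "\<delta> z \<noteq> 0" if z: "z \<in> \<Omega>" for z
  proof -
    obtain g where g: "g \<in> G" "g x = z" using G_transitive[OF x z] .
    thus ?thesis using inv[OF g(1)] x nz by auto
  qed
  have "\<exists>p\<in>\<Omega>. \<delta> p > 0"
  proof (rule ccontr)
    assume "\<not> (\<exists>p\<in>\<Omega>. \<delta> p > 0)"
    hence "(\<Sum>x\<in>\<Omega>. \<delta> x) < (\<Sum>x\<in>\<Omega>. 0)"
      using all_nz x finite_points by (intro sum_strict_mono) force+
    thus False using sum0 by simp
  qed
  then obtain p where p: "p \<in> \<Omega>" "\<delta> p > 0" by blast
  have "\<exists>q\<in>\<Omega>. \<delta> q < 0"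
  proof (rule ccontr)
    assume "\<not> (\<exists>q\<in>\<Omega>. \<delta> q < 0)"
    hence "(\<Sum>x\<in>\<Omega>. 0) < (\<Sum>x\<in>\<Omega>. \<delta> x)"
      using all_nz x finite_points by (intro sum_strict_mono) force+
    thus False using sum0 by simp
  qed
  then obtain q where q: "q \<in> \<Omega>" "\<delta> q < 0" by blast
  have "p \<noteq> q" using p q by auto
  hence "{p, q} \<noteq> \<Omega>" using rc(2) by auto
  then obtain z where z: "z \<in> \<Omega>" "z \<noteq> p" "z \<noteq> q" using p q by blast
  obtain a b where ab: "a \<in> \<Omega>" "b \<in> \<Omega>" "a \<noteq> b" "\<delta> a > 0 \<longleftrightarrow> \<delta> b > 0"
  proof (cases "\<delta> z > 0")
    case True
    thus ?thesis using that[of z p] z p by auto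
  next
    case False
    thus ?thesis using that[of z q] z q by auto
  qed
  obtain Orb where Orb: "Orb \<in> edge_orbits" "{a, b} \<in> Orb"
    using edge_orbit_ex[of "{a, b}"] ab by auto
  have "graph_connected \<Omega> Orb" using edge_orbit_connected rc Orb by blast
  then obtain u v where uv: "{u, v} \<in> Orb" "\<delta> u > 0" "\<not> \<delta> v > 0"
    using graph_connected_cut[of \<Omega> Orb p q "{z. \<delta> z > 0}"] p q by auto
  obtain g where g: "g \<in> G" "g ` {a, b} = {u, v}"
    using edge_orbit_transitive[OF Orb uv(1)] by blast
  obtain \<epsilon> where \<epsilon>: "\<epsilon> \<in> {1, -1}" "\<forall>x\<in>\<Omega>. \<delta> (g x) = \<epsilon> * \<delta> x" using inv[OF g(1)] by blast
  have "\<delta> (g a) > 0 \<longleftrightarrow> \<delta> (g b) > 0"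
    using \<epsilon> ab all_nz[OF ab(1)] all_nz[OF ab(2)] by auto
  moreover have "g a = u \<and> g b = v \<or> g a = v \<and> g b = u"
    using g(2) by (auto simp: doubleton_eq_iff)
  ultimately show False using uv by auto
qed

end

section \<open>Edges crossing a common translate of the kernel partition\<close>

locale rank_two_map = transitive_perm_group +
  fixes t :: "'a \<Rightarrow> 'a" and Orb :: "'a set set"
  assumes t_maps: "t \<in> \<Omega> \<rightarrow>\<^sub>E \<Omega>" and Orb: "Orb \<in> edge_orbits" and t_image: "t ` \<Omega> \<in> Orb"
begin

lemma t_two_valued:
  assumes "x \<in> \<Omega>" "y \<in> \<Omega>" "z \<in> \<Omega>" "t x \<noteq> t y"
  shows "t z = t x \<or> t z = t y"
proof -
  obtain a b where "t ` \<Omega> = {a, b}"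
    using edge_orbit_two_subset[OF Orb t_image] by (auto simp: card_2_iff)
  hence "t x \<in> {a, b}" "t y \<in> {a, b}" "t z \<in> {a, b}" using assms by auto
  thus ?thesis using assms(4) by auto
qed

text \<open>The arc \<open>(x, y)\<close> is the edge \<open>{x, y}\<close> with an orientation.  A step joins two arcs that cross
  some translate of the kernel of \<open>t\<close> in the same direction.  These are the moves that an
  idempotent of the semigroup induces on the image of a map.\<close>

definition arc_step :: "(('a \<times> 'a) \<times> ('a \<times> 'a)) set" where
  "arc_step = {((x1, y1), (x2, y2)). {x1, y1} \<in> Orb \<and> {x2, y2} \<in> Orb \<and>
     (\<exists>g\<in>G. t (g x1) = t (g x2) \<and> t (g y1) = t (g y2) \<and> t (g x1) \<noteq> t (g y1))}"

lemma arc_stepI: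
  assumes "{x1, y1} \<in> Orb" "{x2, y2} \<in> Orb" "g \<in> G"
    "t (g x1) = t (g x2)" "t (g y1) = t (g y2)" "t (g x1) \<noteq> t (g y1)"
  shows "((x1, y1), (x2, y2)) \<in> arc_step"
  using assms unfolding arc_step_def by blast

lemma arc_stepE:
  assumes "(a, b) \<in> arc_step"
  obtains x1 y1 x2 y2 g where "a = (x1, y1)" "b = (x2, y2)" "{x1, y1} \<in> Orb" "{x2, y2} \<in> Orb"
    "g \<in> G" "t (g x1) = t (g x2)" "t (g y1) = t (g y2)" "t (g x1) \<noteq> t (g y1)"
  using assms unfolding arc_step_def by (auto intro: that)

lemma arc_step_sym: "(a, b) \<in> arc_step\<^sup>* \<Longrightarrow> (b, a) \<in> arc_step\<^sup>*"
proof (rule symD[OF sym_rtrancl[OF symI]])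
  fix c d assume "(c, d) \<in> arc_step"
  thus "(d, c) \<in> arc_step"
  proof (rule arc_stepE)
    fix x1 y1 x2 y2 g
    assume "c = (x1, y1)" "d = (x2, y2)" "{x1, y1} \<in> Orb" "{x2, y2} \<in> Orb" "g \<in> G"
      "t (g x1) = t (g x2)" "t (g y1) = t (g y2)" "t (g x1) \<noteq> t (g y1)"
    thus ?thesis using arc_stepI[of x2 y2 x1 y1 g] by simp
  qed
qed

lemma arc_step_swap:
  assumes "((x1, y1), (x2, y2)) \<in> arc_step\<^sup>*"
  shows "((y1, x1), (y2, x2)) \<in> arc_step\<^sup>*"
proof -
  have "(prod.swap a, prod.swap b) \<in> arc_step" if "(a, b) \<in> arc_step" for a b
    using that by (rule arc_stepE) (auto intro: arc_stepI simp: insert_commute)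
  from rtrancl_image[OF assms, of prod.swap, OF this] show ?thesis by simp
qed

lemma arc_step_edge:
  assumes "((x1, y1), (x2, y2)) \<in> arc_step\<^sup>*" "{x1, y1} \<in> Orb"
  shows "{x2, y2} \<in> Orb"
  using assms(1)
proof (cases rule: rtranclE)
  case (step b)
  from step(2) show ?thesis by (rule arc_stepE) simp
qed (use assms in auto)

lemma arc_step_G:
  assumes "((x1, y1), (x2, y2)) \<in> arc_step\<^sup>*" "k \<in> G"
  shows "((k x1, k y1), (k x2, k y2)) \<in> arc_step\<^sup>*"
proof -
  obtain k' where k': "k' \<in> G" "\<forall>x\<in>\<Omega>. k' (k x) = x" using G_inverse[OF assms(2)] by blast
  have "(map_prod k k a, map_prod k k b) \<in> arc_step" if ab: "(a, b) \<in> arc_step" for a b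
  proof -
    obtain u1 v1 u2 v2 g where uv: "a = (u1, v1)" "b = (u2, v2)"
      and g: "{u1, v1} \<in> Orb" "{u2, v2} \<in> Orb" "g \<in> G"
        "t (g u1) = t (g u2)" "t (g v1) = t (g v2)" "t (g u1) \<noteq> t (g v1)"
      using ab by (rule arc_stepE)
    have mem: "u1 \<in> \<Omega>" "v1 \<in> \<Omega>" "u2 \<in> \<Omega>" "v2 \<in> \<Omega>"
      using edge_orbit_points[OF Orb] g by auto
    have "compose \<Omega> g k' (k x) = g x" if "x \<in> \<Omega>" for x
      using that k'(2) G_point[OF assms(2)] by (simp add: compose_def)
    moreover have "{k u1, k v1} \<in> Orb" "{k u2, k v2} \<in> Orb"
      using edge_orbit_closed[OF Orb g(1) assms(2)] edge_orbit_closed[OF Orb g(2) assms(2)]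
      by simp_all
    ultimately show ?thesis
      using g mem G_compose[OF g(3) k'(1)] unfolding uv
      by (auto intro!: arc_stepI[of _ _ _ _ "compose \<Omega> g k'"])
  qed
  from rtrancl_image[OF assms(1), of "map_prod k k", OF this] show ?thesis by simp
qed

lemma arc_step_G_iff:
  assumes "k \<in> G" "x1 \<in> \<Omega>" "y1 \<in> \<Omega>" "x2 \<in> \<Omega>" "y2 \<in> \<Omega>"
  shows "((k x1, k y1), (k x2, k y2)) \<in> arc_step\<^sup>* \<longleftrightarrow> ((x1, y1), (x2, y2)) \<in> arc_step\<^sup>*"
proof -
  obtain k' where k': "k' \<in> G" "\<forall>x\<in>\<Omega>. k' (k x) = x" using G_inverse[OF assms(1)] by blast
  show ?thesis
    using arc_step_G[of "k x1" "k y1" "k x2" "k y2" k'] arc_step_G[of x1 y1 x2 y2 k] k' assms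
    by auto
qed

text \<open>\<open>G\<close> permutes the components of arcs, and reversal of arcs permutes them as well.  Hence an element
  that moves \<open>(x0, y0)\<close> into the component of this arc or into the reverse of that component
  preserves or reverses the orientation which that component gives to its edges.\<close>

lemma arc_step_G_orientation:
  assumes "{x0, y0} \<in> Orb" "k \<in> G"
    and "((x0, y0), (k x0, k y0)) \<in> arc_step\<^sup>* \<or> ((x0, y0), (k y0, k x0)) \<in> arc_step\<^sup>*"
  shows "(\<forall>x\<in>\<Omega>. \<forall>y\<in>\<Omega>. ((x0, y0), (k x, k y)) \<in> arc_step\<^sup>* \<longleftrightarrow> ((x0, y0), (x, y)) \<in> arc_step\<^sup>*) \<or>
    (\<forall>x\<in>\<Omega>. \<forall>y\<in>\<Omega>. ((x0, y0), (k x, k y)) \<in> arc_step\<^sup>* \<longleftrightarrow> ((x0, y0), (y, x)) \<in> arc_step\<^sup>*)"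
  using assms(3)
proof
  have mem: "x0 \<in> \<Omega>" "y0 \<in> \<Omega>" using edge_orbit_points[OF Orb assms(1)] by auto
  {
    assume *: "((x0, y0), (k x0, k y0)) \<in> arc_step\<^sup>*"
    have "((x0, y0), (k x, k y)) \<in> arc_step\<^sup>* \<longleftrightarrow> ((k x0, k y0), (k x, k y)) \<in> arc_step\<^sup>*" for x y
      using * arc_step_sym[OF *] rtrancl_trans[of _ _ arc_step] by blast
    thus ?thesis using arc_step_G_iff[OF assms(2)] mem by simp
  next
    assume *: "((x0, y0), (k y0, k x0)) \<in> arc_step\<^sup>*"
    have "((x0, y0), (k x, k y)) \<in> arc_step\<^sup>* \<longleftrightarrow> ((k y0, k x0), (k x, k y)) \<in> arc_step\<^sup>*" for x y
      using * arc_step_sym[OF *] rtrancl_trans[of _ _ arc_step] by blast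
    moreover have "((k y0, k x0), (k x, k y)) \<in> arc_step\<^sup>* \<longleftrightarrow> ((k x0, k y0), (k y, k x)) \<in> arc_step\<^sup>*" for x y
      using arc_step_swap by blast
    ultimately show ?thesis using arc_step_G_iff[OF assms(2)] mem by simp
  }
qed

text \<open>Once \<open>k\<close> maps one edge of the component to another, it preserves or reverses the component of
  arcs, and in both cases it preserves the set of underlying edges.\<close>

lemma edge_component_block:
  assumes "{x0, y0} \<in> Orb"
  shows "imprimitivity_block (perm_group \<Omega> G) Orb (`)
    {{x, y} | x y. ((x0, y0), (x, y)) \<in> arc_step\<^sup>*}"  (is "imprimitivity_block _ _ _ ?C")
proof -
  have C_iff: "{x, y} \<in> ?C \<longleftrightarrow> ((x0, y0), (x, y)) \<in> arc_step\<^sup>* \<or> ((x0, y0), (y, x)) \<in> arc_step\<^sup>*"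
    for x y by (auto simp: doubleton_eq_iff)
  have sub: "?C \<subseteq> Orb" using arc_step_edge[OF _ assms] by blast
  have "(`) k ` ?C = ?C" if k: "k \<in> G" and meet: "(`) k ` ?C \<inter> ?C \<noteq> {}" for k
  proof -
    obtain c where "c \<in> ?C" "k ` c \<in> ?C" using meet by blast
    then obtain x y where xy: "((x0, y0), (x, y)) \<in> arc_step\<^sup>*" "k ` {x, y} \<in> ?C" by blast
    have kC: "{k x, k y} \<in> ?C" using xy(2) by simp
    have kxy: "((k x, k y), (k x0, k y0)) \<in> arc_step\<^sup>*"
      using arc_step_sym[OF arc_step_G[OF xy(1) k]] .
    have "((x0, y0), (k x0, k y0)) \<in> arc_step\<^sup>* \<or> ((x0, y0), (k y0, k x0)) \<in> arc_step\<^sup>*"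
      using kC kxy arc_step_swap[OF kxy] rtrancl_trans[of _ _ arc_step]
      unfolding C_iff by blast
    note orient = arc_step_G_orientation[OF assms k this]
    have "{k u, k v} \<in> ?C" if uv: "((x0, y0), (u, v)) \<in> arc_step\<^sup>*" for u v
    proof -
      have "u \<in> \<Omega>" "v \<in> \<Omega>" using edge_orbit_points[OF Orb arc_step_edge[OF uv assms]] by auto
      thus ?thesis using orient uv unfolding C_iff by blast
    qed
    hence "(`) k ` ?C \<subseteq> ?C" by auto
    \<comment> \<open>Equality follows from the inclusion by counting.\<close>
    moreover have "inj_on ((`) k) ?C"
      by (rule inj_on_subset[OF inj_on_image_Pow[OF G_inj[OF k]]])
        (use sub edge_orbit_two_subset[OF Orb] in blast)
    moreover have "finite ?C" using sub edge_orbit_finite[OF Orb] finite_subset by blast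
    ultimately show ?thesis by (intro card_subset_eq) (simp_all add: card_image)
  qed
  hence "\<forall>k\<in>G. (`) k ` ?C = ?C \<or> (`) k ` ?C \<inter> ?C = {}" by meson
  moreover have "?C \<noteq> {}" by blast
  ultimately show ?thesis
    unfolding imprimitivity_block_def carrier_perm_group by (intro conjI sub)
qed

lemma crossing_edge_exists:
  assumes "graph_connected \<Omega> E" "g \<in> G"
  obtains x y where "{x, y} \<in> E" "t (g x) \<noteq> t (g y)"
proof -
  obtain a b where "t ` \<Omega> = {a, b}" "a \<noteq> b"
    using edge_orbit_two_subset[OF Orb t_image] by (auto simp: card_2_iff)
  hence "(\<lambda>z. t (g z)) ` \<Omega> = {a, b}" "a \<noteq> b"
    using G_image[OF assms(2)] by (simp_all flip: image_image)
  hence "a \<in> (\<lambda>z. t (g z)) ` \<Omega>" "b \<in> (\<lambda>z. t (g z)) ` \<Omega>" by simp_all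
  then obtain x y where "x \<in> \<Omega>" "y \<in> \<Omega>" "t (g x) = a" "t (g y) = b" by blast
  hence "x \<in> \<Omega>" "y \<in> \<Omega>" "x \<in> {z. t (g z) = a}" "y \<notin> {z. t (g z) = a}"
    using \<open>a \<noteq> b\<close> by simp_all
  from graph_connected_cut[OF assms(1) this]
  obtain u v where "{u, v} \<in> E" "u \<in> {z. t (g z) = a}" "v \<notin> {z. t (g z) = a}" .
  thus thesis by (intro that[of u v]) simp_all
qed

lemma edge_is_crossing:
  assumes "graph_connected \<Omega> Orb" "{x, y} \<in> Orb"
  obtains g where "g \<in> G" "t (g x) \<noteq> t (g y)"
proof -
  obtain u v where uv: "{u, v} \<in> Orb" "t ((\<lambda>x\<in>\<Omega>. x) u) \<noteq> t ((\<lambda>x\<in>\<Omega>. x) v)"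
    using crossing_edge_exists[OF assms(1) G_id] by blast
  hence "t u \<noteq> t v" using edge_orbit_points[OF Orb uv(1)] by simp
  obtain g where g: "g \<in> G" "g ` {x, y} = {u, v}"
    using edge_orbit_transitive[OF Orb assms(2) uv(1)] by blast
  have "t (g x) \<noteq> t (g y)" using g(2) \<open>t u \<noteq> t v\<close> by (auto simp: doubleton_eq_iff)
  thus thesis using that g(1) by blast
qed

text \<open>Choose a translate of the kernel crossed by \<open>{x0, y0}\<close>.  All edges that cross it are
  one step away from \<open>(x0, y0)\<close> or its reverse, hence lie in the edge component.  If this block were
  proper, no edge outside it would join the two sides, against \<open>road_closed\<close>.\<close>

lemma arc_step_reaches_edge:
  assumes rc: "road_closed" "card \<Omega> \<noteq> 2" and e: "{x0, y0} \<in> Orb" "{x, y} \<in> Orb"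
  shows "((x0, y0), (x, y)) \<in> arc_step\<^sup>* \<or> ((x0, y0), (y, x)) \<in> arc_step\<^sup>*"
proof -
  let ?C = "{{x, y} | x y. ((x0, y0), (x, y)) \<in> arc_step\<^sup>*}"
  have C_iff: "{x, y} \<in> ?C \<longleftrightarrow> ((x0, y0), (x, y)) \<in> arc_step\<^sup>* \<or> ((x0, y0), (y, x)) \<in> arc_step\<^sup>*"
    for x y by (auto simp: doubleton_eq_iff)
  have "?C = Orb"
  proof (rule ccontr)
    assume "?C \<noteq> Orb"
    hence conn: "graph_connected \<Omega> (Orb - ?C)"
      by (rule road_closed_proper_block[OF rc(1) Orb edge_component_block[OF e(1)]])
    obtain g where g: "g \<in> G" "t (g x0) \<noteq> t (g y0)"
      using edge_is_crossing[OF edge_orbit_connected[OF rc Orb] e(1)] .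
    obtain u v where uv: "{u, v} \<in> Orb - ?C" "t (g u) \<noteq> t (g v)"
      using crossing_edge_exists[OF conn g(1)] .
    have uvO: "{u, v} \<in> Orb" "{v, u} \<in> Orb" using uv(1) by (simp_all add: insert_commute)
    have mem: "g x0 \<in> \<Omega>" "g y0 \<in> \<Omega>" "g u \<in> \<Omega>" "g v \<in> \<Omega>"
      using edge_orbit_points[OF Orb] uvO(1) e(1) G_point[OF g(1)] by blast+
    have "t (g u) = t (g x0) \<and> t (g v) = t (g y0) \<or> t (g u) = t (g y0) \<and> t (g v) = t (g x0)"
      using t_two_valued[OF mem(1,2,3) g(2)] t_two_valued[OF mem(1,2,4) g(2)] uv(2) by auto
    hence "((x0, y0), (u, v)) \<in> arc_step \<or> ((x0, y0), (v, u)) \<in> arc_step"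
      using arc_stepI[OF e(1) uvO(1) g(1)] arc_stepI[OF e(1) uvO(2) g(1)] g(2) by auto
    hence "{u, v} \<in> ?C" unfolding C_iff by blast
    thus False using uv(1) by blast
  qed
  hence "{x, y} \<in> ?C" using e(2) by (simp only:)
  thus ?thesis by (simp only: C_iff)
qed

text \<open>Otherwise each edge has exactly one orientation that is reachable, and the signed degree
  \<open>\<delta>\<close>, out-degree minus in-degree, is invariant under \<open>G\<close> up to sign.  By
  \<open>signed_invariant_vanishes\<close> it is zero.  But if \<open>P\<close> is the side of \<open>x0\<close> in a translate of the
  kernel crossed by the edge, then all edges that cross it leave \<open>P\<close>, so the sum of \<open>\<delta>\<close> over \<open>P\<close>,
  the net flow out of \<open>P\<close>, is positive.\<close>

lemma arc_step_reverses:
  assumes rc: "road_closed" "card \<Omega> \<noteq> 2" and e: "{x0, y0} \<in> Orb"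
  shows "((x0, y0), (y0, x0)) \<in> arc_step\<^sup>*"
proof (rule ccontr)
  assume nrev: "((x0, y0), (y0, x0)) \<notin> arc_step\<^sup>*"
  define D where "D x y \<longleftrightarrow> ((x0, y0), (x, y)) \<in> arc_step\<^sup>*" for x y
  have D_asym: "\<not> D y x" if "D x y" for x y
  proof
    assume "D y x"
    hence "((y0, x0), (x, y)) \<in> arc_step\<^sup>*" unfolding D_def by (rule arc_step_swap)
    hence "((x, y), (y0, x0)) \<in> arc_step\<^sup>*" by (rule arc_step_sym)
    thus False using that nrev rtrancl_trans unfolding D_def by metis
  qed
  define s :: "'a \<Rightarrow> 'a \<Rightarrow> int" where "s x y = of_bool (D x y) - of_bool (D y x)" for x y
  define \<delta> where "\<delta> x = (\<Sum>y\<in>\<Omega>. s x y)" for x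
  have anti: "s y x = - s x y" for x y by (simp add: s_def)
  have balanced: "(\<Sum>x\<in>P. \<Sum>y\<in>P. s x y) = 0" for P
  proof -
    have "(\<Sum>x\<in>P. \<Sum>y\<in>P. s x y) = (\<Sum>x\<in>P. \<Sum>y\<in>P. s y x)" by (rule sum.swap)
    also have "\<dots> = (\<Sum>x\<in>P. \<Sum>y\<in>P. - s x y)" by (intro sum.cong refl anti)
    also have "\<dots> = - (\<Sum>x\<in>P. \<Sum>y\<in>P. s x y)" by (simp add: sum_negf)
    finally show ?thesis by simp
  qed
  \<comment> \<open>The sign \<open>\<epsilon>\<close> tells whether \<open>k\<close> preserves or reverses the orientation.\<close>
  have inv: "\<exists>\<epsilon>\<in>{1, -1}. \<forall>x\<in>\<Omega>. \<delta> (k x) = \<epsilon> * \<delta> x" if k: "k \<in> G" for k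
  proof -
    have "{k x0, k y0} \<in> Orb" using edge_orbit_closed[OF Orb e k] by simp
    note orient = arc_step_G_orientation[OF e k arc_step_reaches_edge[OF rc e this], folded D_def]
    have "\<exists>\<epsilon>\<in>{1, -1}. \<forall>x\<in>\<Omega>. \<forall>y\<in>\<Omega>. s (k x) (k y) = \<epsilon> * s x y"
      using orient
    proof
      assume "\<forall>x\<in>\<Omega>. \<forall>y\<in>\<Omega>. D (k x) (k y) \<longleftrightarrow> D x y"
      thus ?thesis by (intro bexI[of _ 1]) (auto simp: s_def)
    next
      assume "\<forall>x\<in>\<Omega>. \<forall>y\<in>\<Omega>. D (k x) (k y) \<longleftrightarrow> D y x"
      thus ?thesis by (intro bexI[of _ "-1"]) (auto simp: s_def)
    qed
    then obtain \<epsilon> where \<epsilon>: "\<epsilon> \<in> {1, -1}" "\<forall>x\<in>\<Omega>. \<forall>y\<in>\<Omega>. s (k x) (k y) = \<epsilon> * s x y" by blast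
    have bij: "bij_betw k \<Omega> \<Omega>" using G_inj[OF k] G_image[OF k] by (simp add: bij_betw_def)
    have "\<delta> (k x) = \<epsilon> * \<delta> x" if "x \<in> \<Omega>" for x
    proof -
      have "\<delta> (k x) = (\<Sum>y\<in>\<Omega>. s (k x) (k y))"
        unfolding \<delta>_def by (rule sum.reindex_bij_betw[OF bij, symmetric])
      thus ?thesis using \<epsilon>(2) that by (simp add: \<delta>_def sum_distrib_left)
    qed
    thus ?thesis using \<epsilon>(1) by blast
  qed
  have "(\<Sum>x\<in>\<Omega>. \<delta> x) = 0" using balanced[of \<Omega>] by (simp add: \<delta>_def)
  hence \<delta>0: "\<delta> x = 0" if "x \<in> \<Omega>" for x using signed_invariant_vanishes[OF rc inv] that by blast
  obtain g where g: "g \<in> G" "t (g x0) \<noteq> t (g y0)"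
    using edge_is_crossing[OF edge_orbit_connected[OF rc Orb] e] .
  define P where "P = {z\<in>\<Omega>. t (g z) = t (g x0)}"
  have P: "P \<subseteq> \<Omega>" "finite P" using finite_points by (auto simp: P_def)
  have mem0: "x0 \<in> \<Omega>" "y0 \<in> \<Omega>" using edge_orbit_points[OF Orb e] by auto
  have x0y0: "x0 \<in> P" "y0 \<in> \<Omega> - P" using mem0 g(2) by (auto simp: P_def)
  \<comment> \<open>An arc that enters \<open>P\<close> is the reverse of an arc one step away from \<open>(x0, y0)\<close>.\<close>
  have no_back: "\<not> D v u" if "u \<in> P" "v \<in> \<Omega> - P" for u v
  proof
    assume D: "D v u"
    hence vu: "{v, u} \<in> Orb" using arc_step_edge e unfolding D_def by blast
    hence uv: "{u, v} \<in> Orb" by (simp add: insert_commute)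
    have "t (g u) = t (g x0)" "t (g v) \<noteq> t (g x0)" using that by (auto simp: P_def)
    moreover have "t (g v) = t (g y0)"
      using t_two_valued[of "g x0" "g y0" "g v"] G_point[OF g(1)] mem0 that g(2) calculation by auto
    ultimately have "((x0, y0), (u, v)) \<in> arc_step" using arc_stepI[OF e uv g(1)] g(2) by simp
    hence "D u v" unfolding D_def by blast
    thus False using D D_asym by blast
  qed
  have nonneg: "s x y \<ge> 0" if "x \<in> P" "y \<in> \<Omega> - P" for x y
    using no_back[OF that] by (simp add: s_def)
  have "D x0 y0" by (simp add: D_def)
  hence "s x0 y0 > 0" using nrev by (simp add: s_def D_def)
  hence "(\<Sum>y\<in>\<Omega> - P. s x0 y) > 0"
    using nonneg x0y0 finite_points by (intro sum_pos2[of _ y0]) auto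
  hence "(\<Sum>x\<in>P. \<Sum>y\<in>\<Omega> - P. s x y) > 0"
    using nonneg by (intro sum_pos2[OF P(2) x0y0(1)] sum_nonneg)
  moreover have "(\<Sum>x\<in>P. \<delta> x) = (\<Sum>x\<in>P. \<Sum>y\<in>\<Omega> - P. s x y) + (\<Sum>x\<in>P. \<Sum>y\<in>P. s x y)"
    unfolding \<delta>_def using P finite_points
    by (simp add: sum.subset_diff[of P \<Omega>] sum.distrib)
  moreover have "(\<Sum>x\<in>P. \<delta> x) = 0" using \<delta>0 P(1) by (intro sum.neutral) blast
  ultimately show False using balanced[of P] by simp
qed

lemma arc_step_connected:
  assumes rc: "road_closed" "card \<Omega> \<noteq> 2" and e: "{x0, y0} \<in> Orb" "{x, y} \<in> Orb"
  shows "((x0, y0), (x, y)) \<in> arc_step\<^sup>*"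
  using arc_step_reaches_edge[OF rc e]
proof
  assume "((x0, y0), (y, x)) \<in> arc_step\<^sup>*"
  hence "((y0, x0), (x, y)) \<in> arc_step\<^sup>*" by (rule arc_step_swap)
  thus ?thesis using arc_step_reverses[OF rc e(1)] by (rule rtrancl_trans[rotated])
qed

section \<open>Connected arcs give generation by idempotents\<close>

abbreviation nonunits :: "('a \<Rightarrow> 'a) set" where
  "nonunits \<equiv> semigroup_gen \<Omega> (G \<union> {t}) - G"

abbreviation idempotent_products :: "('a \<Rightarrow> 'a) set" where
  "idempotent_products \<equiv> semigroup_gen \<Omega> {e \<in> nonunits. compose \<Omega> e e = e}"

definition two_valued_map :: "'a set \<Rightarrow> 'a \<Rightarrow> 'a \<Rightarrow> 'a \<Rightarrow> 'a" where
  "two_valued_map P x y = (\<lambda>z\<in>\<Omega>. if z \<in> P then x else y)"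

lemma gen_maps: "f \<in> semigroup_gen \<Omega> (G \<union> {t}) \<Longrightarrow> f \<in> \<Omega> \<rightarrow>\<^sub>E \<Omega>"
  using semigroup_gen_maps[of "G \<union> {t}"] G_maps t_maps by auto

lemma rank_two_not_in_G:
  assumes "card \<Omega> \<noteq> 2" "card (f ` \<Omega>) \<le> 2"
  shows "f \<notin> G"
proof
  assume "f \<in> G"
  hence "card \<Omega> \<le> 2" using G_image assms by metis
  moreover have "2 \<le> card \<Omega>"
    using edge_orbit_two_subset[OF Orb t_image] finite_points card_mono by metis
  ultimately show False using assms(1) by simp
qed

lemma idempotent_products_subset_nonunits:
  assumes "card \<Omega> \<noteq> 2"
  shows "idempotent_products \<subseteq> nonunits"
proof
  fix f assume "f \<in> idempotent_products"
  thus "f \<in> nonunits"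
  proof induction
    case (mult f h)
    have "card (f ` \<Omega>) \<le> 2"
      using semigroup_gen_cases[OF t_maps Orb t_image, of f] mult.IH edge_orbit_two_subset[OF Orb]
      by force
    moreover have "card (compose \<Omega> f h ` \<Omega>) \<le> card (f ` \<Omega>)"
      using compose_rank_le(1) gen_maps mult.IH by blast
    ultimately have "compose \<Omega> f h \<notin> G" using rank_two_not_in_G[OF assms] by simp
    thus ?case using mult.IH by (auto intro: semigroup_gen.mult)
  qed auto
qed

text \<open>Some product \<open>h t g\<close> has the same kernel and image as \<open>e\<close>.  On the image it is either the
  identity or the transposition of the two points; in both cases its square is \<open>e\<close>.\<close>

lemma crossing_idempotent_in_nonunits:
  assumes n2: "card \<Omega> \<noteq> 2" and e: "e \<in> \<Omega> \<rightarrow>\<^sub>E \<Omega>" "compose \<Omega> e e = e" "e ` \<Omega> \<in> Orb"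
    and g: "g \<in> G" "has_kernel e (t \<circ> g)"
  shows "e \<in> nonunits"
proof -
  obtain h where h: "h \<in> G" "h ` t ` \<Omega> = e ` \<Omega>"
    using edge_orbit_transitive[OF Orb t_image e(3)] by blast
  define f where "f = compose \<Omega> h (compose \<Omega> t g)"
  have f_gen: "f \<in> semigroup_gen \<Omega> (G \<union> {t})"
    unfolding f_def using h(1) g(1) by (intro semigroup_gen.mult semigroup_gen.base) auto
  have f_app: "f x = h (t (g x))" if "x \<in> \<Omega>" for x using that by (simp add: f_def compose_def)
  have f_im: "f ` \<Omega> = e ` \<Omega>"
    using h(2) G_image[OF g(1)] by (simp add: f_def compose_image)
  have ker: "f x = f y \<longleftrightarrow> e x = e y" if "x \<in> \<Omega>" "y \<in> \<Omega>" for x y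
  proof -
    have "t (g x) \<in> \<Omega>" "t (g y) \<in> \<Omega>" using that G_point[OF g(1)] t_maps by auto
    thus ?thesis using f_app that G_eq_iff[OF h(1)] g(2) by (simp add: has_kernel_def)
  qed
  obtain u v where uv: "e ` \<Omega> = {u, v}" "u \<noteq> v"
    using edge_orbit_two_subset[OF Orb e(3)] by (auto simp: card_2_iff)
  have mem: "u \<in> \<Omega>" "v \<in> \<Omega>" using uv edge_orbit_two_subset[OF Orb e(3)] by auto
  have ee: "e (e x) = e x" if "x \<in> \<Omega>" for x
    using fun_cong[OF e(2), of x] that by (simp add: compose_def)
  have fixed: "e u = u" "e v = v" using ee uv(1) by (metis imageE insertI1 insertI2)+
  have "f u \<noteq> f v" using ker[OF mem] fixed uv(2) by simp
  moreover have "f u \<in> {u, v}" "f v \<in> {u, v}" using f_im uv(1) mem by blast+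
  ultimately have ff: "f (f u) = u" "f (f v) = v" by auto
  have "compose \<Omega> f f = e"
  proof (rule extensionalityI[of _ \<Omega>])
    show "compose \<Omega> f f x = e x" if x: "x \<in> \<Omega>" for x
    proof -
      have "e x = u \<or> e x = v" using uv(1) x by blast
      moreover have "f x = f u" if "e x = u" using ker[OF x mem(1)] that fixed by simp
      moreover have "f x = f v" if "e x = v" using ker[OF x mem(2)] that fixed by simp
      ultimately show ?thesis using ff x by (auto simp: compose_def)
    qed
  qed (use e(1) in \<open>auto simp: PiE_def compose_def\<close>)
  hence "e \<in> semigroup_gen \<Omega> (G \<union> {t})" using semigroup_gen.mult[OF f_gen f_gen] by simp
  moreover have "e \<notin> G"
    using rank_two_not_in_G[OF n2, of e] edge_orbit_two_subset[OF Orb e(3)] by simp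
  ultimately show ?thesis by simp
qed

lemma crossing_edge_idempotent:
  assumes n2: "card \<Omega> \<noteq> 2" and e: "{x, y} \<in> Orb" and g: "g \<in> G" "t (g x) \<noteq> t (g y)"
  shows "two_valued_map {z. t (g z) = t (g x)} x y \<in> idempotent_products"
proof -
  let ?e = "two_valued_map {z. t (g z) = t (g x)} x y"
  have mem: "x \<in> \<Omega>" "y \<in> \<Omega>" "x \<noteq> y" using edge_orbit_points[OF Orb e] by auto
  have "?e \<in> \<Omega> \<rightarrow>\<^sub>E \<Omega>" using mem by (auto simp: two_valued_map_def)
  moreover have idem: "compose \<Omega> ?e ?e = ?e"
    using mem g(2) by (auto simp: two_valued_map_def compose_def fun_eq_iff)
  moreover have "?e ` \<Omega> = {x, y}" using mem g(2) by (auto simp: two_valued_map_def)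
  moreover have "has_kernel ?e (t \<circ> g)"
    unfolding has_kernel_def
  proof (intro ballI)
    fix a b assume ab: "a \<in> \<Omega>" "b \<in> \<Omega>"
    have "t (g c) = t (g x) \<or> t (g c) = t (g y)" if "c \<in> \<Omega>" for c
      using t_two_valued[OF _ _ _ g(2)] G_point[OF g(1)] mem that by blast
    from this[OF ab(1)] this[OF ab(2)] show "?e a = ?e b \<longleftrightarrow> (t \<circ> g) a = (t \<circ> g) b"
      using ab mem(3) g(2) by (auto simp: two_valued_map_def)
  qed
  ultimately have "?e \<in> nonunits" using crossing_idempotent_in_nonunits[OF n2] e g by metis
  thus ?thesis using idem by (intro semigroup_gen.base) simp
qed

text \<open>The idempotent that maps the side of \<open>x2\<close> to \<open>x2\<close> and the side of \<open>y2\<close> to \<open>y2\<close>, in the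
  partition that both arcs cross, sends \<open>x1\<close> to \<open>x2\<close> and \<open>y1\<close> to \<open>y2\<close>.\<close>

lemma two_valued_map_step:
  assumes n2: "card \<Omega> \<noteq> 2" and f: "two_valued_map P x1 y1 \<in> idempotent_products"
    and step: "((x1, y1), (x2, y2)) \<in> arc_step"
  shows "two_valued_map P x2 y2 \<in> idempotent_products"
proof -
  obtain g where g: "{x1, y1} \<in> Orb" "{x2, y2} \<in> Orb" "g \<in> G"
    "t (g x1) = t (g x2)" "t (g y1) = t (g y2)" "t (g x1) \<noteq> t (g y1)"
    using arc_stepE[OF step] by (metis prod.inject)
  let ?e = "two_valued_map {z. t (g z) = t (g x2)} x2 y2"
  have "?e \<in> idempotent_products" using crossing_edge_idempotent[OF n2 g(2,3)] g by simp
  hence "compose \<Omega> ?e (two_valued_map P x1 y1) \<in> idempotent_products"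
    using f by (rule semigroup_gen.mult)
  moreover have "compose \<Omega> ?e (two_valued_map P x1 y1) = two_valued_map P x2 y2"
    using edge_orbit_points[OF Orb g(1)] g(4-6)
    by (auto simp: two_valued_map_def compose_def fun_eq_iff)
  ultimately show ?thesis by simp
qed

text \<open>A map \<open>f\<close> of rank two shares its kernel with an idempotent whose image is an edge \<open>{x, y}\<close>
  crossing that kernel.  Moving the arc \<open>(x, y)\<close> to \<open>(f x, f y)\<close> by steps turns the idempotent
  into \<open>f\<close>.\<close>

lemma nonunits_subset_idempotent_products:
  assumes rc: "road_closed" "card \<Omega> \<noteq> 2"
  shows "nonunits \<subseteq> idempotent_products"
proof
  fix f assume f: "f \<in> nonunits"
  have maps: "f \<in> \<Omega> \<rightarrow>\<^sub>E \<Omega>" using f gen_maps by blast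
  consider (const) "card (f ` \<Omega>) \<le> 1"
    | (two) "f ` \<Omega> \<in> Orb" "\<exists>g\<in>G. has_kernel f (t \<circ> g)"
    using semigroup_gen_cases[OF t_maps Orb t_image, of f] f by blast
  thus "f \<in> idempotent_products"
  proof cases
    case const
    have "card (f ` \<Omega>) \<le> Suc 0" using const by simp
    from iffD1[OF card_le_Suc0_iff_eq this] finite_points
    have "\<forall>u\<in>f ` \<Omega>. \<forall>v\<in>f ` \<Omega>. u = v" by blast
    moreover have "f a \<in> \<Omega>" if "a \<in> \<Omega>" for a using maps that by blast
    ultimately have "f (f a) = f a" if "a \<in> \<Omega>" for a using that by blast
    hence "compose \<Omega> f f = f"
      using maps by (intro extensionalityI[of _ \<Omega>]) (auto simp: compose_def PiE_def)
    thus ?thesis using f by (intro semigroup_gen.base) simp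
  next
    case two
    then obtain g where g: "g \<in> G" "has_kernel f (t \<circ> g)" by blast
    obtain x y where xy: "{x, y} \<in> Orb" "t (g x) \<noteq> t (g y)"
      using crossing_edge_exists[OF edge_orbit_connected[OF rc Orb] g(1)] .
    let ?P = "{z. t (g z) = t (g x)}"
    have mem: "x \<in> \<Omega>" "y \<in> \<Omega>" using edge_orbit_points[OF Orb xy(1)] by auto
    have ker: "f a = f b \<longleftrightarrow> t (g a) = t (g b)" if "a \<in> \<Omega>" "b \<in> \<Omega>" for a b
      using g(2) that by (simp add: has_kernel_def)
    have f_eq: "f = two_valued_map ?P (f x) (f y)"
    proof (rule extensionalityI[of _ \<Omega>])
      show "f z = two_valued_map ?P (f x) (f y) z" if z: "z \<in> \<Omega>" for z
      proof -
        have "t (g z) = t (g x) \<or> t (g z) = t (g y)"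
          using t_two_valued[OF _ _ _ xy(2)] G_point[OF g(1)] mem z by blast
        thus ?thesis
          using z ker[OF z mem(1)] ker[OF z mem(2)] by (auto simp: two_valued_map_def)
      qed
    qed (use maps in \<open>auto simp: PiE_def two_valued_map_def\<close>)
    have "f ` \<Omega> = {f x, f y}"
    proof -
      obtain a b where ab: "f ` \<Omega> = {a, b}"
        using edge_orbit_two_subset[OF Orb two(1)] by (auto simp: card_2_iff)
      moreover have "f x \<noteq> f y" using ker[OF mem] xy(2) by simp
      moreover have "f x \<in> {a, b}" "f y \<in> {a, b}" using ab mem by blast+
      ultimately show ?thesis by auto
    qed
    hence "{f x, f y} \<in> Orb" using two(1) by simp
    from arc_step_connected[OF rc xy(1) this]
    have "two_valued_map ?P (fst (f x, f y)) (snd (f x, f y)) \<in> idempotent_products"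
    proof induction
      case base
      show ?case using crossing_edge_idempotent[OF rc(2) xy(1) g(1) xy(2)] by simp
    next
      case (step b c)
      thus ?case using two_valued_map_step[OF rc(2), of ?P "fst b" "snd b" "fst c" "snd c"] by simp
    qed
    thus ?thesis using f_eq by simp
  qed
qed

end

section \<open>The equivalence\<close>

context transitive_perm_group
begin

lemma rank_two_on_two_points:
  assumes "card \<Omega> = 2" "f \<in> \<Omega> \<rightarrow>\<^sub>E \<Omega>" "card (f ` \<Omega>) = 2"
  shows "f \<in> G"
proof -
  obtain a b where ab: "\<Omega> = {a, b}" "a \<noteq> b" using assms(1) by (auto simp: card_2_iff)
  have mem: "f a \<in> {a, b}" "f b \<in> {a, b}" using assms(2) ab by auto
  have "f a \<noteq> f b" using assms(3) ab by auto
  obtain g where g: "g \<in> G" "g a = f a" using G_transitive[of a "f a"] mem ab by auto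
  have "g b \<in> {a, b}" "g b \<noteq> g a" using G_point[OF g(1)] G_eq_iff[OF g(1)] ab by auto
  hence "g b = f b" using g(2) mem \<open>f a \<noteq> f b\<close> by auto
  hence "f = g"
    using g assms(2) G_maps[OF g(1)] ab
    by (intro extensionalityI[of _ \<Omega>]) (auto simp: PiE_def)
  thus ?thesis using g by simp
qed

theorem road_closed_imp_two_id:
  assumes "road_closed"
  shows "k_id_property 2 \<Omega> G"
  unfolding k_id_property_def
proof (intro ballI impI)
  fix t assume t: "t \<in> \<Omega> \<rightarrow>\<^sub>E \<Omega>" "map_rank \<Omega> t = 2"
  have t_im: "t ` \<Omega> \<subseteq> \<Omega>" "card (t ` \<Omega>) = 2" using t by (auto simp: map_rank_def)
  show "idempotent_generated \<Omega> (semigroup_gen \<Omega> (G \<union> {t}) - G)"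
  proof (cases "card \<Omega> = 2")
    case True
    have "t \<in> G" using rank_two_on_two_points[OF True t(1) t_im(2)] .
    have "f \<in> G" if "f \<in> semigroup_gen \<Omega> (G \<union> {t})" for f
      using that by induction (use \<open>t \<in> G\<close> G_compose in auto)
    hence S_empty: "semigroup_gen \<Omega> (G \<union> {t}) - G = {}" by blast
    have "f \<notin> semigroup_gen \<Omega> {}" for f
    proof
      assume "f \<in> semigroup_gen \<Omega> {}" thus False by induction auto
    qed
    hence "semigroup_gen \<Omega> {} = {}" by blast
    thus ?thesis unfolding idempotent_generated_def S_empty by simp
  next
    case False
    obtain Orb where "Orb \<in> edge_orbits" "t ` \<Omega> \<in> Orb" using edge_orbit_ex[OF t_im] .
    then interpret rank_two_map \<Omega> G t Orb
      using t(1) transitive_perm_group_axioms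
      by (intro rank_two_map.intro rank_two_map_axioms.intro)
    show ?thesis
      unfolding idempotent_generated_def
      using idempotent_products_subset_nonunits[OF False]
        nonunits_subset_idempotent_products[OF assms False]
      by (rule equalityI)
  qed
qed

theorem two_id_iff_road_closed: "k_id_property 2 \<Omega> G \<longleftrightarrow> road_closed"
proof
  assume id2: "k_id_property 2 \<Omega> G"
  show road_closed
    unfolding road_closed_def
  proof (intro ballI allI impI)
    fix Orb B assume Orb: "Orb \<in> edge_orbits" and "maximal_block (perm_group \<Omega> G) Orb (`) B"
    hence "imprimitivity_block (perm_group \<Omega> G) Orb (`) B" "B \<noteq> Orb"
      by (simp_all add: maximal_block_def)
    thus "graph_connected \<Omega> (Orb - B)" by (rule two_id_imp_connected[OF id2 Orb])
  qed
qed (rule road_closed_imp_two_id)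

end

theorem theorem1p3:
  fixes \<Omega> :: "'a set" and G :: "('a \<Rightarrow> 'a) set"
  assumes "finite \<Omega>"
    and "subgroup G (BijGroup \<Omega>)"
    and "transitive_action (perm_group \<Omega> G) \<Omega> (\<lambda>g. g)"
  shows "k_id_property 2 \<Omega> G \<longleftrightarrow>
    (\<forall>Orb \<in> orbits (perm_group \<Omega> G) (two_subsets \<Omega>) (`).
       \<forall>B. maximal_block (perm_group \<Omega> G) Orb (`) B \<longrightarrow> graph_connected \<Omega> (Orb - B))"
proof -
  interpret transitive_perm_group \<Omega> G using assms by (rule transitive_perm_group.intro)
  show ?thesis using two_id_iff_road_closed unfolding road_closed_def edge_orbits_def .
qed

end
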